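(* Let $T$ be a Kragujevac tree with $t$ branches, of order $n=1+\sum_{i=1}^t(2s_i+1)$, where $s_i$ is the number of end vertices of $T$ in the $i$-th branch of $T$. Then for every vertex $a'\in V(T)$, $$d_d(a')=s_1+s_2+\dots+s_t+1.$$
   Context: A dominating set of a finite simple graph $G$ is a set $D\subseteq V(G)$ such that every vertex in $V(G)\setminus D$ is adjacent to some vertex of $D$. A minimal dominating set is a dominating set that does not properly contain any other dominating set. The domination degree of a vertex $a$ is $d_d(a)=\min\{|D| : D \text{ is a minimal dominating set of } G \text{ with } a\in D\}$. For $k\ge 1$, let $\mathscr{B}_k$ be the rooted tree obtained from $k$ copies of the path $P_3$ on three vertices, each rooted at one of its end vertices, by identifying their roots; the root of $\mathscr{B}_k$ is the identified vertex (so $\mathscr{B}_k$ has $2k+1$ vertices). Let $t\ge 2$ and $\beta_1,\dots,\beta_t\in\{\mathscr{B}_1,\mathscr{B}_2,\dots\}$. A Kragujevac tree $T$ is the tree consisting of a vertex $a$ of degree $t$ (the central vertex) adjacent to the roots of (disjoint copies of) $\beta_1,\dots,\beta_t$; the $\beta_i$ are called the branches of $T$. Thus $\beta_i=\mathscr{B}_{s_i}$. An end vertex is a vertex of degree 1. *)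

theory Defs
  imports "Graph_Theory.Pair_Digraph"
begin

text \<open>
  A finite simple graph is a \<^locale>\<open>pair_graph\<close>: a finite, loop-free digraph without parallel
  arcs whose arc relation is symmetric, each edge being represented by its two orientations.
  Hence the degree of a vertex is its \<^const>\<open>out_degree\<close>.
\<close>

definition dominating_set :: "'a pair_pre_digraph \<Rightarrow> 'a set \<Rightarrow> bool" where
  "dominating_set G D \<longleftrightarrow>
     D \<subseteq> pverts G \<and> (\<forall>v \<in> pverts G - D. \<exists>u \<in> D. (v, u) \<in> parcs G)"

definition minimal_dominating_set :: "'a pair_pre_digraph \<Rightarrow> 'a set \<Rightarrow> bool" where
  "minimal_dominating_set G D \<longleftrightarrow>
     dominating_set G D \<and> \<not> (\<exists>D'. D' \<subset> D \<and> dominating_set G D')"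

text \<open>
  For a finite graph and a vertex \<open>a\<close> of it the set below is finite, and it is nonempty because a
  maximal independent set containing \<open>a\<close> is a minimal dominating set.
\<close>

definition domination_degree :: "'a pair_pre_digraph \<Rightarrow> 'a \<Rightarrow> nat" where
  "domination_degree G a = Min {card D | D. minimal_dominating_set G D \<and> a \<in> D}"

definition end_vertex :: "'a pair_pre_digraph \<Rightarrow> 'a \<Rightarrow> bool" where
  "end_vertex G v \<longleftrightarrow> v \<in> pverts G \<and> out_degree (with_proj G) v = 1"

text \<open>\<open>P\<close> is a path on three vertices and \<open>r\<close> is one of its end vertices.\<close>

definition rooted_P3 :: "'a pair_pre_digraph \<Rightarrow> 'a \<Rightarrow> bool" where
  "rooted_P3 P r \<longleftrightarrow>
     (\<exists>x y. distinct [r, x, y] \<and> pverts P = {r, x, y} \<and>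
            parcs P = {(r, x), (x, r), (x, y), (y, x)})"

text \<open>
  \<open>B\<close> with root \<open>r\<close> is a copy, on arbitrary vertices, of the rooted tree \<open>\<B>\<^sub>k\<close>. Identifying the
  roots of \<open>k\<close> disjoint copies of the path is expressed by copies \<open>P 1, \<dots>, P k\<close> which all have the
  root \<open>r\<close> and share no other vertex.
\<close>

definition rooted_B :: "nat \<Rightarrow> 'a pair_pre_digraph \<Rightarrow> 'a \<Rightarrow> bool" where
  "rooted_B k B r \<longleftrightarrow>
     (\<exists>P. (\<forall>j \<in> {1..k}. rooted_P3 (P j) r) \<and>
          (\<forall>i \<in> {1..k}. \<forall>j \<in> {1..k}. i \<noteq> j \<longrightarrow> pverts (P i) \<inter> pverts (P j) = {r}) \<and>
          pverts B = (\<Union>j \<in> {1..k}. pverts (P j)) \<and>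
          parcs B = (\<Union>j \<in> {1..k}. parcs (P j)))"

text \<open>
  \<open>T\<close> is a Kragujevac tree with central vertex \<open>a\<close> and branches \<open>\<beta> 1, \<dots>, \<beta> t\<close>, which are pairwise
  disjoint subgraphs of \<open>T\<close> with roots \<open>\<rho> 1, \<dots>, \<rho> t\<close>.
\<close>

definition kragujevac_tree ::
  "'a pair_pre_digraph \<Rightarrow> 'a \<Rightarrow> nat \<Rightarrow> (nat \<Rightarrow> 'a pair_pre_digraph) \<Rightarrow> (nat \<Rightarrow> 'a) \<Rightarrow> bool" where
  "kragujevac_tree T a t \<beta> \<rho> \<longleftrightarrow>
     t \<ge> 2 \<and>
     (\<forall>i \<in> {1..t}. \<exists>k \<ge> 1. rooted_B k (\<beta> i) (\<rho> i)) \<and>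
     (\<forall>i \<in> {1..t}. a \<notin> pverts (\<beta> i)) \<and>
     (\<forall>i \<in> {1..t}. \<forall>j \<in> {1..t}. i \<noteq> j \<longrightarrow> pverts (\<beta> i) \<inter> pverts (\<beta> j) = {}) \<and>
     pverts T = insert a (\<Union>i \<in> {1..t}. pverts (\<beta> i)) \<and>
     parcs T = (\<Union>i \<in> {1..t}. {(a, \<rho> i), (\<rho> i, a)} \<union> parcs (\<beta> i))"

lemma pair_graphI:
  assumes "finite (pverts G)"
    and "\<And>u v. (u, v) \<in> parcs G \<Longrightarrow> u \<in> pverts G \<and> u \<noteq> v \<and> (v, u) \<in> parcs G"
  shows "pair_graph G"
proof -
  have sub: "parcs G \<subseteq> pverts G \<times> pverts G"
  proof (rule subrelI)
    fix u v assume "(u, v) \<in> parcs G"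
    then show "(u, v) \<in> pverts G \<times> pverts G"
      using assms(2)[of u v] assms(2)[of v u] by simp
  qed
  have fin: "finite (parcs G)"
    by (rule finite_subset[OF sub]) (simp add: assms(1))
  have sym: "symmetric (with_proj G)"
    using assms(2) by (simp add: symmetric_def sym_def)
  show ?thesis
    by unfold_locales (use assms fin sym subsetD[OF sub] in \<open>auto\<close>)
qed

lemma rooted_P3_props:
  assumes "rooted_P3 P r"
  shows "r \<in> pverts P" and "finite (pverts P)"
    and "(u, v) \<in> parcs P \<Longrightarrow> u \<in> pverts P \<and> u \<noteq> v \<and> (v, u) \<in> parcs P"
  using assms unfolding rooted_P3_def by auto

lemma rooted_B_props:
  assumes "rooted_B k B r"
  shows "k \<ge> 1 \<Longrightarrow> r \<in> pverts B" and "finite (pverts B)"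
    and "(u, v) \<in> parcs B \<Longrightarrow> u \<in> pverts B \<and> u \<noteq> v \<and> (v, u) \<in> parcs B"
proof -
  obtain P where P': "\<forall>j \<in> {1..k}. rooted_P3 (P j) r"
    and V: "pverts B = (\<Union>j \<in> {1..k}. pverts (P j))"
    and A: "parcs B = (\<Union>j \<in> {1..k}. parcs (P j))"
    using assms unfolding rooted_B_def by (elim exE conjE) (rule that)
  have P: "rooted_P3 (P j) r" if "j \<in> {1..k}" for j
    using P' that by blast
  show "r \<in> pverts B" if "k \<ge> 1"
  proof -
    have "1 \<in> {1..k}" using that by simp
    then show ?thesis unfolding V by (rule UN_I) (rule rooted_P3_props(1)[OF P], fact)
  qed
  show "finite (pverts B)"
    unfolding V by (intro finite_UN_I finite_atLeastAtMost rooted_P3_props(2)[OF P])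
  show "u \<in> pverts B \<and> u \<noteq> v \<and> (v, u) \<in> parcs B" if uv: "(u, v) \<in> parcs B"
  proof -
    obtain j where j: "j \<in> {1..k}" "(u, v) \<in> parcs (P j)"
      using uv unfolding A by (elim UN_E) (rule that)
    show ?thesis
      using rooted_P3_props(3)[OF P[OF j(1)] j(2)] j(1) unfolding V A by blast
  qed
qed

lemma kragujevac_tree_pair_graph:
  assumes "kragujevac_tree T a t \<beta> \<rho>"
  shows "pair_graph T"
proof (rule pair_graphI)
  have B: "\<exists>k \<ge> 1. rooted_B k (\<beta> i) (\<rho> i)" and a: "a \<notin> pverts (\<beta> i)" if "i \<in> {1..t}" for i
    using assms that unfolding kragujevac_tree_def by blast+
  have V: "pverts T = insert a (\<Union>i \<in> {1..t}. pverts (\<beta> i))"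
    and A: "parcs T = (\<Union>i \<in> {1..t}. {(a, \<rho> i), (\<rho> i, a)} \<union> parcs (\<beta> i))"
    using assms unfolding kragujevac_tree_def by blast+
  have root: "\<rho> i \<in> pverts (\<beta> i)" and fin: "finite (pverts (\<beta> i))"
    and edge: "\<And>u v. (u, v) \<in> parcs (\<beta> i) \<Longrightarrow> u \<in> pverts (\<beta> i) \<and> u \<noteq> v \<and> (v, u) \<in> parcs (\<beta> i)"
    if i: "i \<in> {1..t}" for i
  proof -
    obtain k where "k \<ge> 1" and k: "rooted_B k (\<beta> i) (\<rho> i)"
      using B[OF i] by (elim exE conjE) (rule that)
    then show "\<rho> i \<in> pverts (\<beta> i)"
      by (intro rooted_B_props(1)[OF k])
    show "finite (pverts (\<beta> i))"
      by (rule rooted_B_props(2)[OF k])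
    show "u \<in> pverts (\<beta> i) \<and> u \<noteq> v \<and> (v, u) \<in> parcs (\<beta> i)" if "(u, v) \<in> parcs (\<beta> i)" for u v
      by (rule rooted_B_props(3)[OF k that])
  qed
  show "finite (pverts T)"
    unfolding V using fin by simp
  fix u v assume "(u, v) \<in> parcs T"
  then obtain i where i: "i \<in> {1..t}"
    and "(u, v) = (a, \<rho> i) \<or> (u, v) = (\<rho> i, a) \<or> (u, v) \<in> parcs (\<beta> i)"
    unfolding A by blast
  then consider "u = a" "v = \<rho> i" | "u = \<rho> i" "v = a" | "(u, v) \<in> parcs (\<beta> i)"
    by blast
  then show "u \<in> pverts T \<and> u \<noteq> v \<and> (v, u) \<in> parcs T"
  proof cases
    case 1
    then show ?thesis using i root[OF i] a[OF i] unfolding V A by blast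
  next
    case 2
    then show ?thesis using i root[OF i] a[OF i] unfolding V A by blast
  next
    case 3
    then have "u \<in> pverts (\<beta> i) \<and> u \<noteq> v \<and> (v, u) \<in> parcs (\<beta> i)"
      by (rule edge[OF i])
    then show ?thesis using i unfolding V A by blast
  qed
qed

end

theory Submission
  imports Defs
begin

text \<open>
  Write the branch with root \<open>\<rho> i\<close> as legs \<open>\<rho> i - x i j - y i j\<close>, one for each of its end vertices
  \<open>y i j\<close>. The closed neighbourhoods \<open>{x i j, y i j}\<close> of the end vertices and the closed
  neighbourhood \<open>{a, \<rho> 1, \<dots>, \<rho> t}\<close> of the centre partition the vertex set. Counting these
  blocks gives the order of the tree. A dominating set meets
  each of them, so it has at least \<open>s\<^sub>1 + \<dots> + s\<^sub>t + 1\<close> elements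
  (\<open>packing_card_le_dominating_set\<close>).

  This bound is attained by three kinds of dominating sets: all \<open>x i j\<close> together with \<open>a\<close>, all
  \<open>x i j\<close> together with one root, and all \<open>y i j\<close> together with \<open>a\<close>. A dominating set of least size
  is in particular minimal for inclusion, and these sets cover all vertices, so the domination
  degree of every vertex is the domination number (\<open>domination_degree_eqI\<close>).
\<close>

section \<open>Dominating sets and packings\<close>

definition closed_neighbourhood :: "'a pair_pre_digraph \<Rightarrow> 'a \<Rightarrow> 'a set" where
  "closed_neighbourhood G v = insert v {u. (v, u) \<in> parcs G}"

lemma dominating_set_meets_closed_neighbourhood:
  assumes "dominating_set G D" "v \<in> pverts G"
  shows "\<exists>u \<in> D. u \<in> closed_neighbourhood G v"
  using assms unfolding dominating_set_def closed_neighbourhood_def by blast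

text \<open>The packing number of a graph is at most its domination number: picking for every vertex of
  the packing one element of \<open>D\<close> that dominates it is injective.\<close>

lemma packing_card_le_dominating_set:
  assumes fin: "finite (pverts G)" and D: "dominating_set G D"
    and S: "S \<subseteq> pverts G"
    and packing: "\<And>u v. u \<in> S \<Longrightarrow> v \<in> S \<Longrightarrow> u \<noteq> v \<Longrightarrow>
      closed_neighbourhood G u \<inter> closed_neighbourhood G v = {}"
  shows "card S \<le> card D"
proof -
  have "\<forall>v \<in> S. \<exists>u. u \<in> D \<and> u \<in> closed_neighbourhood G v"
    using dominating_set_meets_closed_neighbourhood[OF D] S by blast
  then obtain f where f: "\<forall>v \<in> S. f v \<in> D \<and> f v \<in> closed_neighbourhood G v"
    by (rule bchoice[THEN exE])
  have "inj_on f S"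
  proof (rule inj_onI)
    fix u v assume "u \<in> S" "v \<in> S" "f u = f v"
    then have "f u \<in> closed_neighbourhood G u \<inter> closed_neighbourhood G v"
      using f by force
    then show "u = v"
      using packing \<open>u \<in> S\<close> \<open>v \<in> S\<close> by blast
  qed
  moreover have "f ` S \<subseteq> D"
    using f by blast
  moreover have "finite D"
    using D fin unfolding dominating_set_def by (blast intro: finite_subset)
  ultimately show ?thesis
    by (rule card_inj_on_le)
qed

text \<open>A dominating set of least cardinality cannot properly contain another one, so it is one of
  the sets over which the minimum is taken.\<close>

lemma domination_degree_eqI:
  assumes fin: "finite (pverts G)" and D: "dominating_set G D" and v: "v \<in> D"
    and least: "\<And>E. dominating_set G E \<Longrightarrow> card D \<le> card E"
  shows "domination_degree G v = card D"
  unfolding domination_degree_def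
proof (rule Min_eqI)
  have "{card E | E. minimal_dominating_set G E \<and> v \<in> E} \<subseteq> card ` Pow (pverts G)"
    unfolding minimal_dominating_set_def dominating_set_def by blast
  then show "finite {card E | E. minimal_dominating_set G E \<and> v \<in> E}"
    using fin by (blast intro: finite_subset)
next
  fix n assume "n \<in> {card E | E. minimal_dominating_set G E \<and> v \<in> E}"
  then show "card D \<le> n"
    using least unfolding minimal_dominating_set_def by blast
next
  have "finite D"
    using D fin unfolding dominating_set_def by (blast intro: finite_subset)
  then have "\<not> dominating_set G E" if "E \<subset> D" for E
    using psubset_card_mono[OF _ that] least[of E] by (meson leD)
  then have "minimal_dominating_set G D"
    using D unfolding minimal_dominating_set_def by blast
  then show "card D \<in> {card E | E. minimal_dominating_set G E \<and> v \<in> E}"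
    using v by blast
qed

lemma end_vertex_iff_unique_neighbour:
  "end_vertex G v \<longleftrightarrow> v \<in> pverts G \<and> (\<exists>!u. (v, u) \<in> parcs G)"
proof -
  have "out_arcs (with_proj G) v = Pair v ` {u. (v, u) \<in> parcs G}"
    by (auto simp: out_arcs_def)
  then have "out_degree (with_proj G) v = card {u. (v, u) \<in> parcs G}"
    unfolding out_degree_def by (simp add: card_image inj_on_def)
  moreover have "card {u. (v, u) \<in> parcs G} = 1 \<longleftrightarrow> (\<exists>!u. (v, u) \<in> parcs G)"
    by (simp only: One_nat_def card_1_singleton_iff) (auto simp: set_eq_iff)
  ultimately show ?thesis
    unfolding end_vertex_def by simp
qed

section \<open>Labelling the legs of a branch\<close>

text \<open>Bundling these facts about the legs \<open>r - x j - y j\<close> in one predicate lets the labels of all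
  branches of a tree be chosen simultaneously.\<close>

definition branch_labelling ::
  "nat \<Rightarrow> 'a pair_pre_digraph \<Rightarrow> 'a \<Rightarrow> (nat \<Rightarrow> 'a) \<Rightarrow> (nat \<Rightarrow> 'a) \<Rightarrow> bool" where
  "branch_labelling k B r x y \<longleftrightarrow>
     inj_on x {1..k} \<and> inj_on y {1..k} \<and> x ` {1..k} \<inter> y ` {1..k} = {} \<and>
     r \<notin> x ` {1..k} \<union> y ` {1..k} \<and>
     pverts B = insert r (x ` {1..k} \<union> y ` {1..k}) \<and>
     parcs B = (\<Union>j \<in> {1..k}. {(r, x j), (x j, r), (x j, y j), (y j, x j)})"

lemma rooted_B_labelling:
  assumes k: "k \<ge> 1" and B: "rooted_B k B r"
  shows "\<exists>x y. branch_labelling k B r x y"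
proof -
  obtain P where P: "\<forall>j \<in> {1..k}. rooted_P3 (P j) r"
    and disj: "\<forall>i \<in> {1..k}. \<forall>j \<in> {1..k}. i \<noteq> j \<longrightarrow> pverts (P i) \<inter> pverts (P j) = {r}"
    and V: "pverts B = (\<Union>j \<in> {1..k}. pverts (P j))"
    and A: "parcs B = (\<Union>j \<in> {1..k}. parcs (P j))"
    using B unfolding rooted_B_def by (elim exE conjE) (rule that)
  obtain x y where xy: "distinct [r, x j, y j]" "pverts (P j) = {r, x j, y j}"
    "parcs (P j) = {(r, x j), (x j, r), (x j, y j), (y j, x j)}" if "j \<in> {1..k}" for j
    using P unfolding rooted_P3_def by metis
  have same: "i = j"
    if "i \<in> {1..k}" "j \<in> {1..k}" "u \<in> {x i, y i}" "u \<in> {x j, y j}" for i j u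
  proof (rule ccontr)
    assume "i \<noteq> j"
    then have "{r, x i, y i} \<inter> {r, x j, y j} = {r}"
      using disj that(1,2) xy(2) by metis
    then have "u = r"
      using that(3,4) by blast
    then show False
      using xy(1)[OF that(1)] that(3) by auto
  qed
  have "inj_on x {1..k}" "inj_on y {1..k}"
    using same by (intro inj_onI; metis insertCI)+
  moreover have "x ` {1..k} \<inter> y ` {1..k} = {}"
  proof -
    have "x i \<noteq> y j" if "i \<in> {1..k}" "j \<in> {1..k}" for i j
      using same[of i j "x i"] xy(1)[of i] that by auto
    then show ?thesis
      by blast
  qed
  moreover have "r \<notin> x ` {1..k} \<union> y ` {1..k}"
    using xy(1) by force
  moreover have "pverts B = insert r (x ` {1..k} \<union> y ` {1..k})"
  proof -
    have "1 \<in> {1..k}"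
      using k by simp
    moreover have "pverts B = (\<Union>j \<in> {1..k}. {r, x j, y j})"
      unfolding V by (rule SUP_cong[OF refl xy(2)])
    ultimately show ?thesis
      by blast
  qed
  moreover have "parcs B = (\<Union>j \<in> {1..k}. {(r, x j), (x j, r), (x j, y j), (y j, x j)})"
    unfolding A by (rule SUP_cong[OF refl xy(3)])
  ultimately show ?thesis
    unfolding branch_labelling_def by blast
qed

section \<open>Vertices and edges of a labelled Kragujevac tree\<close>

locale labelled_kragujevac_tree =
  fixes T :: "'a pair_pre_digraph" and a :: 'a and t :: nat
    and \<beta> :: "nat \<Rightarrow> 'a pair_pre_digraph" and \<rho> :: "nat \<Rightarrow> 'a"
    and k :: "nat \<Rightarrow> nat" and x y :: "nat \<Rightarrow> nat \<Rightarrow> 'a"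
  assumes tree: "kragujevac_tree T a t \<beta> \<rho>"
    and k_pos: "i \<in> {1..t} \<Longrightarrow> k i \<ge> 1"
    and labelling: "i \<in> {1..t} \<Longrightarrow> branch_labelling (k i) (\<beta> i) (\<rho> i) (x i) (y i)"
begin

definition middles :: "'a set" where
  "middles = (\<Union>i \<in> {1..t}. x i ` {1..k i})"

definition ends :: "'a set" where
  "ends = (\<Union>i \<in> {1..t}. y i ` {1..k i})"

lemma finite_verts: "finite (pverts T)"
proof -
  interpret pair_graph T
    by (rule kragujevac_tree_pair_graph[OF tree])
  show ?thesis
    by (rule pair_finite_verts)
qed

lemma branch_verts:
  assumes "i \<in> {1..t}"
  shows "pverts (\<beta> i) = insert (\<rho> i) (x i ` {1..k i} \<union> y i ` {1..k i})"
  using labelling[OF assms] unfolding branch_labelling_def by (elim conjE)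

lemma branch_arcs:
  assumes "i \<in> {1..t}"
  shows "parcs (\<beta> i) =
    (\<Union>j \<in> {1..k i}. {(\<rho> i, x i j), (x i j, \<rho> i), (x i j, y i j), (y i j, x i j)})"
  using labelling[OF assms] unfolding branch_labelling_def by (elim conjE)

lemma verts: "pverts T = insert a (\<rho> ` {1..t} \<union> middles \<union> ends)"
proof -
  have "pverts T = insert a (\<Union>i \<in> {1..t}. pverts (\<beta> i))"
    using tree unfolding kragujevac_tree_def by (elim conjE)
  also have "\<dots> = insert a (\<Union>i \<in> {1..t}. insert (\<rho> i) (x i ` {1..k i} \<union> y i ` {1..k i}))"
    using branch_verts by simp
  finally show ?thesis
    unfolding middles_def ends_def by auto
qed

lemma parcs_eq:
  "parcs T = (\<Union>i \<in> {1..t}. {(a, \<rho> i), (\<rho> i, a)} \<union>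
     (\<Union>j \<in> {1..k i}. {(\<rho> i, x i j), (x i j, \<rho> i), (x i j, y i j), (y i j, x i j)}))"
proof -
  have "parcs T = (\<Union>i \<in> {1..t}. {(a, \<rho> i), (\<rho> i, a)} \<union> parcs (\<beta> i))"
    using tree unfolding kragujevac_tree_def by (elim conjE)
  also have "\<dots> = (\<Union>i \<in> {1..t}. {(a, \<rho> i), (\<rho> i, a)} \<union>
      (\<Union>j \<in> {1..k i}. {(\<rho> i, x i j), (x i j, \<rho> i), (x i j, y i j), (y i j, x i j)}))"
    by (rule SUP_cong[OF refl]) (simp only: branch_arcs)
  finally show ?thesis .
qed

lemma arcE:
  assumes "(u, v) \<in> parcs T"
  obtains i where "i \<in> {1..t}" "u = a" "v = \<rho> i"
  | i where "i \<in> {1..t}" "u = \<rho> i" "v = a"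
  | i j where "i \<in> {1..t}" "j \<in> {1..k i}" "u = \<rho> i" "v = x i j"
  | i j where "i \<in> {1..t}" "j \<in> {1..k i}" "u = x i j" "v = \<rho> i"
  | i j where "i \<in> {1..t}" "j \<in> {1..k i}" "u = x i j" "v = y i j"
  | i j where "i \<in> {1..t}" "j \<in> {1..k i}" "u = y i j" "v = x i j"
  using assms unfolding parcs_eq by (elim UN_E UnE insertE emptyE Pair_inject)

lemma arcs:
  assumes "i \<in> {1..t}"
  shows "(a, \<rho> i) \<in> parcs T" "(\<rho> i, a) \<in> parcs T"
    and "j \<in> {1..k i} \<Longrightarrow> (\<rho> i, x i j) \<in> parcs T"
    and "j \<in> {1..k i} \<Longrightarrow> (x i j, \<rho> i) \<in> parcs T"
    and "j \<in> {1..k i} \<Longrightarrow> (x i j, y i j) \<in> parcs T"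
    and "j \<in> {1..k i} \<Longrightarrow> (y i j, x i j) \<in> parcs T"
  unfolding parcs_eq using assms by (blast intro: UN_I)+

lemma same_branch:
  assumes "i \<in> {1..t}" "i' \<in> {1..t}" "v \<in> pverts (\<beta> i)" "v \<in> pverts (\<beta> i')"
  shows "i = i'"
proof (rule ccontr)
  assume "i \<noteq> i'"
  then have "pverts (\<beta> i) \<inter> pverts (\<beta> i') = {}"
    using tree assms(1,2) unfolding kragujevac_tree_def by metis
  then show False
    using assms(3,4) by blast
qed

lemma centre_notin_branch: "i \<in> {1..t} \<Longrightarrow> a \<notin> pverts (\<beta> i)"
  using tree unfolding kragujevac_tree_def by metis

lemma in_branch:
  assumes "i \<in> {1..t}"
  shows "\<rho> i \<in> pverts (\<beta> i)"
    and "j \<in> {1..k i} \<Longrightarrow> x i j \<in> pverts (\<beta> i)"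
    and "j \<in> {1..k i} \<Longrightarrow> y i j \<in> pverts (\<beta> i)"
  using branch_verts[OF assms] by auto

lemma distinct_kinds_in_branch:
  assumes "i \<in> {1..t}" "j \<in> {1..k i}" "j' \<in> {1..k i}"
  shows "x i j \<noteq> y i j'" "\<rho> i \<noteq> x i j" "\<rho> i \<noteq> y i j"
    and "x i j = x i j' \<Longrightarrow> j = j'" "y i j = y i j' \<Longrightarrow> j = j'"
proof -
  have inj: "inj_on (x i) {1..k i}" "inj_on (y i) {1..k i}"
    and disj: "x i ` {1..k i} \<inter> y i ` {1..k i} = {}" "\<rho> i \<notin> x i ` {1..k i} \<union> y i ` {1..k i}"
    using labelling[OF assms(1)] unfolding branch_labelling_def by blast+
  show "x i j \<noteq> y i j'" "\<rho> i \<noteq> x i j" "\<rho> i \<noteq> y i j"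
    using disj assms(2,3) by blast+
  show "x i j = x i j' \<Longrightarrow> j = j'" "y i j = y i j' \<Longrightarrow> j = j'"
    using inj[THEN inj_onD] assms(2,3) by blast+
qed

lemma distinct_kinds:
  assumes "i \<in> {1..t}" "j \<in> {1..k i}" "i' \<in> {1..t}"
  shows "a \<noteq> \<rho> i" "a \<noteq> x i j" "a \<noteq> y i j"
    and "\<rho> i' \<noteq> x i j" "\<rho> i' \<noteq> y i j"
    and "j' \<in> {1..k i'} \<Longrightarrow> x i' j' \<noteq> y i j"
    and "j' \<in> {1..k i'} \<Longrightarrow> x i' j' = x i j \<Longrightarrow> i' = i \<and> j' = j"
    and "j' \<in> {1..k i'} \<Longrightarrow> y i' j' = y i j \<Longrightarrow> i' = i \<and> j' = j"
proof -
  note i = assms(1) and j = assms(2) and i' = assms(3)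
  note branch = in_branch[OF i] in_branch[OF i']
  show "a \<noteq> \<rho> i" "a \<noteq> x i j" "a \<noteq> y i j"
    using centre_notin_branch[OF i] branch j by metis+
  show "\<rho> i' \<noteq> x i j" "\<rho> i' \<noteq> y i j"
    using same_branch[OF i' i] branch j distinct_kinds_in_branch(2,3)[OF i j j] by metis+
  show "x i' j' \<noteq> y i j" if "j' \<in> {1..k i'}"
    using same_branch[OF i' i] branch j that distinct_kinds_in_branch(1)[OF i _ j] by metis
  show "i' = i \<and> j' = j" if "j' \<in> {1..k i'}" "x i' j' = x i j"
    using same_branch[OF i' i] branch j that distinct_kinds_in_branch(4)[OF i _ j] by metis
  show "i' = i \<and> j' = j" if "j' \<in> {1..k i'}" "y i' j' = y i j"
    using same_branch[OF i' i] branch j that distinct_kinds_in_branch(5)[OF i _ j] by metis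
qed

lemma ends_neighbour:
  assumes "i \<in> {1..t}" "j \<in> {1..k i}"
  shows "(y i j, u) \<in> parcs T \<longleftrightarrow> u = x i j"
proof
  assume "(y i j, u) \<in> parcs T"
  then show "u = x i j"
    by (cases rule: arcE) (use distinct_kinds(3,5,6,8)[OF assms] in metis)+
qed (use arcs(6)[OF assms] in blast)

lemma centre_neighbour: "(a, u) \<in> parcs T \<longleftrightarrow> u \<in> \<rho> ` {1..t}"
proof
  assume "(a, u) \<in> parcs T"
  then show "u \<in> \<rho> ` {1..t}"
    by (cases rule: arcE) (use centre_notin_branch in_branch in \<open>metis imageI\<close>)+
qed (use arcs in blast)

text \<open>A root has the centre and some \<open>x i j\<close> as neighbours. So it is never an end vertex of the tree,
  although it is one of its own branch when the branch has a single leg.\<close>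

lemma end_vertices_of_branch:
  assumes i: "i \<in> {1..t}"
  shows "{v \<in> pverts (\<beta> i). end_vertex T v} = y i ` {1..k i}"
proof -
  have one: "1 \<in> {1..k i}"
    using k_pos[OF i] by simp
  have "end_vertex T (y i j)" if j: "j \<in> {1..k i}" for j
  proof -
    have "y i j \<in> pverts T"
      unfolding verts ends_def using i j by blast
    then show ?thesis
      unfolding end_vertex_iff_unique_neighbour using ends_neighbour[OF i j] by simp
  qed
  moreover have "\<not> end_vertex T (x i j)" if j: "j \<in> {1..k i}" for j
    using arcs(4,5)[OF i j] distinct_kinds(5)[OF i j i]
    unfolding end_vertex_iff_unique_neighbour by blast
  moreover have "\<not> end_vertex T (\<rho> i)"
    using arcs(2)[OF i] arcs(3)[OF i one] distinct_kinds(2)[OF i one i]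
    unfolding end_vertex_iff_unique_neighbour by blast
  ultimately show ?thesis
    unfolding branch_verts[OF i] by blast
qed

lemma card_legs:
  assumes "i \<in> {1..t}"
  shows "card (x i ` {1..k i}) = k i" "card (y i ` {1..k i}) = k i"
  using labelling[OF assms] by (simp_all add: branch_labelling_def card_image)

lemma card_union_over_branches:
  assumes "\<And>i. i \<in> {1..t} \<Longrightarrow> A i \<subseteq> pverts (\<beta> i)" "\<And>i. i \<in> {1..t} \<Longrightarrow> finite (A i)"
  shows "card (\<Union>i \<in> {1..t}. A i) = (\<Sum>i = 1..t. card (A i))"
proof (rule card_UN_disjoint[OF finite_atLeastAtMost])
  show "\<forall>i \<in> {1..t}. finite (A i)"
    using assms(2) by (rule ballI)
  show "\<forall>i \<in> {1..t}. \<forall>j \<in> {1..t}. i \<noteq> j \<longrightarrow> A i \<inter> A j = {}"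
  proof (intro ballI impI)
    fix i j assume "i \<in> {1..t}" "j \<in> {1..t}" "i \<noteq> j"
    then show "A i \<inter> A j = {}"
      using same_branch[of i j] assms(1)[of i] assms(1)[of j] by blast
  qed
qed

lemma card_middles: "card middles = (\<Sum>i = 1..t. k i)"
proof -
  have "card middles = (\<Sum>i = 1..t. card (x i ` {1..k i}))"
    unfolding middles_def
    by (rule card_union_over_branches) (use in_branch(2) in blast, simp)
  also have "\<dots> = (\<Sum>i = 1..t. k i)"
    by (rule sum.cong[OF refl card_legs(1)])
  finally show ?thesis .
qed

lemma card_ends: "card ends = (\<Sum>i = 1..t. k i)"
proof -
  have "card ends = (\<Sum>i = 1..t. card (y i ` {1..k i}))"
    unfolding ends_def
    by (rule card_union_over_branches) (use in_branch(3) in blast, simp)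
  also have "\<dots> = (\<Sum>i = 1..t. k i)"
    by (rule sum.cong[OF refl card_legs(2)])
  finally show ?thesis .
qed

lemma card_roots: "card (\<rho> ` {1..t}) = t"
proof -
  have "inj_on \<rho> {1..t}"
    using in_branch(1) same_branch by (metis inj_onI)
  then show ?thesis
    by (simp add: card_image)
qed

lemma kinds_disjoint:
  "a \<notin> \<rho> ` {1..t} \<union> middles \<union> ends"
  "\<rho> ` {1..t} \<inter> (middles \<union> ends) = {}" "middles \<inter> ends = {}"
proof -
  show "a \<notin> \<rho> ` {1..t} \<union> middles \<union> ends"
    using centre_notin_branch in_branch unfolding middles_def ends_def by blast
  show "\<rho> ` {1..t} \<inter> (middles \<union> ends) = {}"
    using distinct_kinds(4,5) unfolding middles_def ends_def by blast
  show "middles \<inter> ends = {}"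
    using distinct_kinds(6) unfolding middles_def ends_def by blast
qed

lemma finite_kinds: "finite middles" "finite ends"
  unfolding middles_def ends_def by simp_all

lemma card_verts: "card (pverts T) = 1 + (\<Sum>i = 1..t. 2 * k i + 1)"
proof -
  have "card (pverts T) = Suc (card (\<rho> ` {1..t} \<union> (middles \<union> ends)))"
    unfolding verts using kinds_disjoint(1) finite_kinds by (simp add: Un_assoc)
  also have "\<dots> = Suc (t + (card middles + card ends))"
    using kinds_disjoint(2,3) finite_kinds by (simp add: card_Un_disjoint card_roots del: One_nat_def)
  finally show ?thesis
    by (simp add: card_middles card_ends sum.distrib sum_distrib_left mult_2 del: One_nat_def)
qed

section \<open>Smallest dominating sets of a Kragujevac tree\<close>

text \<open>The centre and the end vertices form a packing: \<open>{x i j, y i j}\<close> and \<open>{a, \<rho> 1, \<dots>, \<rho> t}\<close> are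
  their closed neighbourhoods.\<close>

lemma dominating_set_card_ge:
  assumes D: "dominating_set T D"
  shows "(\<Sum>i = 1..t. k i) + 1 \<le> card D"
proof -
  have N_end: "closed_neighbourhood T (y i j) = {y i j, x i j}"
    if "i \<in> {1..t}" "j \<in> {1..k i}" for i j
    unfolding closed_neighbourhood_def using ends_neighbour[OF that] by blast
  have N_centre: "closed_neighbourhood T a = insert a (\<rho> ` {1..t})"
    unfolding closed_neighbourhood_def using centre_neighbour by blast
  have centre_end: "closed_neighbourhood T a \<inter> closed_neighbourhood T v = {}" if "v \<in> ends" for v
  proof -
    obtain i j where ij: "i \<in> {1..t}" "j \<in> {1..k i}" and v: "v = y i j"
      using \<open>v \<in> ends\<close> unfolding ends_def by blast
    show ?thesis
      unfolding v N_centre N_end[OF ij] using distinct_kinds(2,3)[OF ij ij(1)] distinct_kinds(4,5)[OF ij] by blast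
  qed
  have end_end: "closed_neighbourhood T u \<inter> closed_neighbourhood T v = {}"
    if "u \<in> ends" "v \<in> ends" "u \<noteq> v" for u v
  proof -
    obtain i j where ij: "i \<in> {1..t}" "j \<in> {1..k i}" and u: "u = y i j"
      using \<open>u \<in> ends\<close> unfolding ends_def by blast
    obtain i' j' where ij': "i' \<in> {1..t}" "j' \<in> {1..k i'}" and v: "v = y i' j'"
      using \<open>v \<in> ends\<close> unfolding ends_def by blast
    have "\<not> (i' = i \<and> j' = j)"
      using \<open>u \<noteq> v\<close> unfolding u v by blast
    then have "x i' j' \<noteq> x i j"
      using distinct_kinds(7)[OF ij ij'] by blast
    moreover have "x i' j' \<noteq> y i j" "x i j \<noteq> y i' j'"
      by (rule distinct_kinds(6)[OF ij ij'], rule distinct_kinds(6)[OF ij' ij])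
    ultimately show ?thesis
      using \<open>u \<noteq> v\<close> unfolding u v N_end[OF ij] N_end[OF ij'] by auto
  qed
  have "card (insert a ends) \<le> card D"
  proof (rule packing_card_le_dominating_set[OF finite_verts D])
    show "insert a ends \<subseteq> pverts T"
      unfolding verts by blast
    show "closed_neighbourhood T u \<inter> closed_neighbourhood T v = {}"
      if uv: "u \<in> insert a ends" "v \<in> insert a ends" "u \<noteq> v" for u v
    proof -
      consider "u = a" "v \<in> ends" | "u \<in> ends" "v = a" | "u \<in> ends" "v \<in> ends"
        using uv by blast
      then show ?thesis
      proof cases
        case 1
        then show ?thesis
          using centre_end[of v] by simp
      next
        case 2
        then show ?thesis
          using centre_end[of u] by (simp add: Int_commute)
      next
        case 3
        then show ?thesis
          using end_end \<open>u \<noteq> v\<close> by simp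
      qed
    qed
  qed
  then show ?thesis
    using kinds_disjoint(1) finite_kinds(2) card_ends by simp
qed

text \<open>The middle vertices dominate everything except the centre, which any vertex of its closed
  neighbourhood takes care of.\<close>

lemma dominating_set_middles:
  assumes c: "c \<in> insert a (\<rho> ` {1..t})"
  shows "dominating_set T (insert c middles)"
  unfolding dominating_set_def
proof (intro conjI ballI)
  show "insert c middles \<subseteq> pverts T"
    using c unfolding verts by blast
  fix v assume "v \<in> pverts T - insert c middles"
  then consider "v = a" "c \<in> \<rho> ` {1..t}" | i where "i \<in> {1..t}" "v = \<rho> i" | "v \<in> ends"
    using c unfolding verts by blast
  then show "\<exists>u \<in> insert c middles. (v, u) \<in> parcs T"
  proof cases
    case 1
    then show ?thesis
      using centre_neighbour by blast
  next
    case (2 i)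
    have "1 \<in> {1..k i}"
      using k_pos[OF 2(1)] by simp
    then show ?thesis
      using arcs(3)[OF 2(1)] 2 unfolding middles_def by blast
  next
    case 3
    then show ?thesis
      using arcs(6) unfolding ends_def middles_def by blast
  qed
qed

text \<open>The end vertices alone dominate neither the centre nor the roots; the centre repairs both.\<close>

lemma dominating_set_ends: "dominating_set T (insert a ends)"
  unfolding dominating_set_def
proof (intro conjI ballI)
  show "insert a ends \<subseteq> pverts T"
    unfolding verts by blast
  fix v assume "v \<in> pverts T - insert a ends"
  then consider "v \<in> \<rho> ` {1..t}" | "v \<in> middles"
    unfolding verts by blast
  then show "\<exists>u \<in> insert a ends. (v, u) \<in> parcs T"
  proof cases
    case 1
    then show ?thesis
      using arcs(2) by blast
  next
    case 2
    then show ?thesis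
      using arcs(5) unfolding ends_def middles_def by blast
  qed
qed

lemma domination_degree_vertex:
  assumes v: "v \<in> pverts T"
  shows "domination_degree T v = (\<Sum>i = 1..t. k i) + 1"
proof -
  have card_M: "card (insert c middles) = (\<Sum>i = 1..t. k i) + 1"
    if "c \<in> insert a (\<rho> ` {1..t})" for c
  proof -
    have "c \<notin> middles"
      using that kinds_disjoint by blast
    then show ?thesis
      using finite_kinds(1) card_middles by simp
  qed
  have card_E: "card (insert a ends) = (\<Sum>i = 1..t. k i) + 1"
    using kinds_disjoint(1) finite_kinds(2) card_ends by simp
  have "\<exists>D. dominating_set T D \<and> v \<in> D \<and> card D = (\<Sum>i = 1..t. k i) + 1"
  proof (cases "v \<in> ends")
    case True
    then show ?thesis
      using dominating_set_ends card_E by blast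
  next
    case False
    then consider "v \<in> insert a (\<rho> ` {1..t})" | "v \<in> middles"
      using v unfolding verts by blast
    then show ?thesis
      using dominating_set_middles card_M by cases blast+
  qed
  then obtain D where D: "dominating_set T D" "v \<in> D" "card D = (\<Sum>i = 1..t. k i) + 1"
    by blast
  show ?thesis
    using domination_degree_eqI[OF finite_verts D(1,2)] dominating_set_card_ge D(3) by simp
qed

end

lemma kragujevac_tree_labelled:
  assumes tree: "kragujevac_tree T a t \<beta> \<rho>"
  shows "\<exists>k x y. labelled_kragujevac_tree T a t \<beta> \<rho> k x y"
proof -
  have "\<forall>i \<in> {1..t}. \<exists>k x y. k \<ge> 1 \<and> branch_labelling k (\<beta> i) (\<rho> i) x y"
  proof
    fix i assume "i \<in> {1..t}"
    then obtain k where "k \<ge> 1" "rooted_B k (\<beta> i) (\<rho> i)"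
      using tree unfolding kragujevac_tree_def by metis
    then show "\<exists>k x y. k \<ge> 1 \<and> branch_labelling k (\<beta> i) (\<rho> i) x y"
      using rooted_B_labelling by metis
  qed
  then obtain k x y
    where "\<forall>i \<in> {1..t}. k i \<ge> 1 \<and> branch_labelling (k i) (\<beta> i) (\<rho> i) (x i) (y i)"
    by metis
  then have "labelled_kragujevac_tree T a t \<beta> \<rho> k x y"
    by unfold_locales (use tree in blast)+
  then show ?thesis
    by blast
qed

theorem theorem3p20:
  fixes T :: "'a pair_pre_digraph" and a :: 'a and t :: nat
    and \<beta> :: "nat \<Rightarrow> 'a pair_pre_digraph" and \<rho> :: "nat \<Rightarrow> 'a" and s :: "nat \<Rightarrow> nat"
  assumes "kragujevac_tree T a t \<beta> \<rho>"
    and "\<And>i. i \<in> {1..t} \<Longrightarrow> s i = card {v \<in> pverts (\<beta> i). end_vertex T v}"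
  shows "card (pverts T) = 1 + (\<Sum>i = 1..t. (2 * s i + 1)) \<and>
         (\<forall>a' \<in> pverts T. domination_degree T a' = (\<Sum>i = 1..t. s i) + 1)"
proof -
  obtain k x y where "labelled_kragujevac_tree T a t \<beta> \<rho> k x y"
    using kragujevac_tree_labelled[OF assms(1)] by blast
  then interpret labelled_kragujevac_tree T a t \<beta> \<rho> k x y .
  have "s i = k i" if "i \<in> {1..t}" for i
    using assms(2)[OF that] end_vertices_of_branch[OF that] card_legs(2)[OF that] by simp
  then have "(\<Sum>i = 1..t. s i) = (\<Sum>i = 1..t. k i)"
    and "(\<Sum>i = 1..t. (2 * s i + 1)) = (\<Sum>i = 1..t. (2 * k i + 1))"
    by (auto intro: sum.cong)
  then show ?thesis
    using card_verts domination_degree_vertex by simp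
qed

end
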